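(* Let $b$ be a positive odd integer and let $q$ be an odd prime. If $q > 2\sqrt{2b}$, then there are no positive integers $k, y$ such that $$(2^{k}-1)(b^{k}-1)=y^{q}.$$ *)

theory Defs
  imports Complex_Main "HOL-Computational_Algebra.Primes"
begin

end

theory Submission
  imports Defs "HOL-Number_Theory.Residues"
begin

text \<open>
  Suppose \<open>(2\<^sup>k - 1) (b\<^sup>k - 1) = y\<^sup>q\<close>. If a prime \<open>p \<le> q\<close> satisfies \<open>p - 1 dvd k\<close>, then \<open>p\<close>
  divides the left-hand side, hence so does \<open>p\<^sup>q\<close>. Lifting the exponent bounds the \<open>p\<close>-part of the
  left-hand side by a quantity depending only on \<open>b\<close>, \<open>p\<close> and the \<open>p\<close>-part of \<open>k\<close>, so the latter must
  be large: since \<open>8 b < q\<^sup>2\<close>, every power of \<open>p\<close> that is at most \<open>q\<close> divides \<open>k\<close>. Strong induction on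
  \<open>p\<close> removes the condition \<open>p - 1 dvd k\<close>, because the prime powers dividing \<open>p - 1\<close> are smaller than
  \<open>q\<close> and belong to smaller primes. For \<open>p = q\<close> this yields \<open>q dvd k\<close>, say \<open>k = q m\<close>. But then the
  left-hand side lies strictly between the consecutive \<open>q\<close>-th powers of \<open>(2 b)\<^sup>m - 1\<close> and \<open>(2 b)\<^sup>m\<close>.
\<close>

section \<open>Lifting the exponent\<close>

text \<open>The cofactor is the geometric sum of the powers of \<open>x\<close>, which is congruent
  to \<open>m\<close> modulo \<open>p\<close> because \<open>x\<close> is congruent to 1.\<close>

lemma power_minus_one_coprime_exponent:
  fixes p x :: int
  assumes "prime p" "p dvd x - 1" "\<not> p dvd int m"
  shows "\<exists>u. \<not> p dvd u \<and> x ^ m - 1 = (x - 1) * u"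
proof -
  have "[x = 1] (mod p)"
    using assms(2) by (simp add: cong_iff_dvd_diff)
  then have "[(\<Sum>i<m. x ^ i) = (\<Sum>i<m. 1 ^ i)] (mod p)"
    by (intro cong_sum cong_pow)
  then have "[(\<Sum>i<m. x ^ i) = int m] (mod p)"
    by simp
  then have "\<not> p dvd (\<Sum>i<m. x ^ i)"
    using assms(3) cong_dvd_iff by blast
  then show ?thesis
    using power_diff_1_eq[of x m] by blast
qed

text \<open>Writing \<open>x = 1 + p * t\<close>, the geometric sum is
  \<open>p + p * t * (p * (p - 1) / 2)\<close> modulo the square of \<open>p\<close>. As
  \<open>p\<close> is odd, the second term vanishes, so the sum contains exactly one factor
  \<open>p\<close>.\<close>

lemma power_prime_minus_one:
  fixes p :: nat and x :: int
  assumes "prime p" "odd p" "int p dvd x - 1"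
  shows "\<exists>u. \<not> int p dvd u \<and> x ^ p - 1 = (x - 1) * int p * u"
proof -
  obtain t where t: "x = 1 + int p * t"
    using assms(3) by (metis add.commute diff_add_cancel dvdE)
  obtain s where s: "p = 2 * s + 1"
    using assms(2) by (elim oddE)
  have pow: "[x ^ i = 1 + int i * (int p * t)] (mod (int p)\<^sup>2)" for i
  proof (induction i)
    case (Suc i)
    have "[x * x ^ i = (1 + int p * t) * (1 + int i * (int p * t))] (mod (int p)\<^sup>2)"
      using cong_mult[OF cong_refl Suc, of x] t by simp
    also have "(1 + int p * t) * (1 + int i * (int p * t)) =
        1 + int (Suc i) * (int p * t) + (int p)\<^sup>2 * (int i * t\<^sup>2)"
      by (simp add: algebra_simps power2_eq_square)
    also have "[\<dots> = 1 + int (Suc i) * (int p * t)] (mod (int p)\<^sup>2)"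
      by (simp add: cong_iff_dvd_diff)
    finally show ?case by simp
  qed simp
  have gauss: "(\<Sum>i<2 * n + 1. int i) = int (2 * n + 1) * int n" for n
    by (induction n) (simp_all add: algebra_simps)
  have "[(\<Sum>i<p. x ^ i) = (\<Sum>i<p. 1 + int i * (int p * t))] (mod (int p)\<^sup>2)"
    by (intro cong_sum pow)
  also have "(\<Sum>i<p. 1 + int i * (int p * t)) = int p + (\<Sum>i<p. int i) * (int p * t)"
    by (simp add: sum.distrib sum_distrib_right)
  also have "\<dots> = int p + (int p)\<^sup>2 * (int s * t)"
    using gauss[of s] s by (simp add: power2_eq_square)
  also have "[\<dots> = int p] (mod (int p)\<^sup>2)"
    by (simp add: cong_iff_dvd_diff)
  finally obtain c where "(\<Sum>i<p. x ^ i) - int p = (int p)\<^sup>2 * c"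
    by (auto simp: cong_iff_dvd_diff)
  then have c: "(\<Sum>i<p. x ^ i) = int p * (1 + int p * c)"
    by (simp add: algebra_simps power2_eq_square)
  have "\<not> int p dvd 1 + int p * c"
    using prime_gt_1_nat[OF assms(1)] by (simp add: dvd_add_left_iff)
  moreover have "x ^ p - 1 = (x - 1) * int p * (1 + int p * c)"
    using power_diff_1_eq[of x p] c by simp
  ultimately show ?thesis by blast
qed

lemma lifting_the_exponent_odd:
  fixes p :: nat and x :: int
  assumes "prime p" "odd p" "int p dvd x - 1" "\<not> p dvd m"
  shows "\<exists>u. \<not> int p dvd u \<and> x ^ (p ^ v * m) - 1 = (x - 1) * int p ^ v * u"
proof (induction v)
  case 0
  show ?case
    using power_minus_one_coprime_exponent[of "int p" x m] assms by simp
next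
  case (Suc v)
  then obtain u where u: "\<not> int p dvd u" "x ^ (p ^ v * m) - 1 = (x - 1) * int p ^ v * u"
    by blast
  then have "int p dvd x ^ (p ^ v * m) - 1"
    using assms(3) by simp
  then obtain w where w: "\<not> int p dvd w"
      "(x ^ (p ^ v * m)) ^ p - 1 = (x ^ (p ^ v * m) - 1) * int p * w"
    using power_prime_minus_one[OF assms(1,2)] by blast
  have "\<not> int p dvd u * w"
    using u(1) w(1) assms(1) by (simp add: prime_dvd_mult_iff)
  moreover have "x ^ (p ^ Suc v * m) - 1 = (x - 1) * int p ^ Suc v * (u * w)"
    using w(2) u(2) by (simp add: power_mult[symmetric] mult_ac)
  ultimately show ?case by blast
qed

lemma prime_power_dvd_cancel_right:
  fixes p a u :: int
  assumes "prime p" "\<not> p dvd u" "p ^ j dvd a * u"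
  shows "p ^ j dvd a"
proof -
  have "coprime (p ^ j) u"
    using assms(1,2) by (simp add: prime_imp_coprime)
  then show ?thesis
    using assms(3) by (simp add: coprime_dvd_mult_left_iff)
qed

lemma fermat_theorem_int:
  fixes p :: nat and x :: int
  assumes "prime p" "\<not> int p dvd x"
  shows "[x ^ (p - 1) = 1] (mod int p)"
proof -
  define a where "a = nat (x mod int p)"
  have a: "int a = x mod int p"
    using prime_gt_0_nat[OF assms(1)] unfolding a_def by simp
  then have "\<not> p dvd a"
    using assms(2) by (metis dvd_mod_iff dvd_refl of_nat_dvd_iff)
  then have "[a ^ (p - 1) = 1] (mod p)"
    using assms(1) by (rule fermat_theorem[rotated])
  then have "[int a ^ (p - 1) = 1] (mod int p)"
    by (metis cong_int_iff of_nat_1 of_nat_power)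
  moreover have "[x ^ (p - 1) = int a ^ (p - 1)] (mod int p)"
    unfolding a by (intro cong_pow) (simp add: cong_def)
  ultimately show ?thesis
    by (rule cong_trans[rotated])
qed

text \<open>By Fermat and lifting, the \<open>p\<close>-part of \<open>x ^ k - 1\<close> is that of
  \<open>x ^ (p - 1) - 1\<close> times that of \<open>k\<close>. With
  \<open>h = (p - 1) div 2\<close>, the former splits as \<open>(x ^ h - 1) * (x ^ h + 1)\<close>,
  and \<open>p\<close> divides at most one factor. This saves a square root over the bound
  \<open>x ^ (p - 1)\<close>.\<close>

lemma odd_prime_power_dvd_power_minus_one_le:
  fixes p :: nat and x :: int
  assumes p: "prime p" "odd p" and x: "x \<ge> 2" and k: "k > 0" "p - 1 dvd k"
    and dvd: "int p ^ j dvd x ^ k - 1"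
  shows "int p ^ j \<le> (x ^ ((p - 1) div 2) + 1) * int p ^ multiplicity p k"
proof (cases "j = 0")
  case True
  have "1 * 1 \<le> (x ^ ((p - 1) div 2) + 1) * int p ^ multiplicity p k"
    using x prime_gt_0_nat[OF p(1)] by (intro mult_mono) auto
  then show ?thesis using True by simp
next
  case False
  define h where "h = (p - 1) div 2"
  define v where "v = multiplicity p k"
  have p2: "p > 2"
    using p prime_ge_2_nat[of p] by (cases "p = 2") auto
  have ph: "p - 1 = 2 * h"
    using p(2) unfolding h_def by simp
  then have h: "h > 0"
    using p2 by linarith
  have prime: "prime (int p)"
    using p(1) by simp
  obtain m where m: "k = p ^ v * m" "\<not> p dvd m"
    unfolding v_def using multiplicity_decompose'[of k p] k(1) p(1)
    by (metis not_prime_unit not_gr_zero)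
  \<comment> \<open>The divisor \<open>p - 1\<close> of \<open>k\<close> must be moved into the
    \<open>p\<close>-free part \<open>m\<close>, so that lifting applies to the base
    \<open>x ^ (p - 1)\<close>.\<close>
  have "coprime (p - 1) p"
    using p(1) prime_gt_0_nat[of p] by (metis coprime_commute coprime_diff_one_right_nat)
  then have "coprime (p - 1) (p ^ v)"
    by simp
  then have "p - 1 dvd m"
    using k(2) m(1) coprime_dvd_mult_right_iff by blast
  then obtain m' where m': "m = (p - 1) * m'"
    by blast
  have nd: "\<not> int p dvd x"
  proof
    assume *: "int p dvd x"
    have "int p dvd x ^ k - 1"
      using dvd False dvd_trans[OF dvd_power[of j "int p"]] by simp
    moreover have "int p dvd x ^ k"
      using * k(1) by (simp add: dvd_power_iff dvd_trans[OF * dvd_power])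
    ultimately have "int p dvd 1"
      using dvd_diff[of "int p" "x ^ k" "x ^ k - 1"] by simp
    then show False
      using p2 by simp
  qed
  have fermat: "int p dvd x ^ (p - 1) - 1"
    using fermat_theorem_int[OF p(1) nd] by (simp add: cong_iff_dvd_diff)
  have "\<not> p dvd m'"
    using m(2) m' by auto
  then obtain u where u: "\<not> int p dvd u"
      "(x ^ (p - 1)) ^ (p ^ v * m') - 1 = (x ^ (p - 1) - 1) * int p ^ v * u"
    using lifting_the_exponent_odd[OF p fermat] by blast
  have "(x ^ (p - 1)) ^ (p ^ v * m') = x ^ k"
    using m(1) m' by (simp add: power_mult[symmetric] mult_ac)
  then have "int p ^ j dvd (x ^ (p - 1) - 1) * int p ^ v * u"
    using dvd u(2) by metis
  then have dvd': "int p ^ j dvd (x ^ (p - 1) - 1) * int p ^ v"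
    using prime_power_dvd_cancel_right[OF prime u(1)] by blast
  have fac: "x ^ (p - 1) - 1 = (x ^ h - 1) * (x ^ h + 1)"
    unfolding ph by (simp add: power_mult mult.commute[of 2] power2_eq_square algebra_simps)
  have pos: "x ^ h > 1"
    using x h by simp
  \<comment> \<open>The two factors differ by 2, which is smaller than \<open>p\<close>.\<close>
  consider "\<not> int p dvd x ^ h - 1" | "\<not> int p dvd x ^ h + 1"
  proof (cases "int p dvd x ^ h - 1")
    case True
    have "\<not> int p dvd x ^ h + 1"
    proof
      assume "int p dvd x ^ h + 1"
      then have "int p dvd (x ^ h + 1) - (x ^ h - 1)"
        using True by (rule dvd_diff)
      then have "int p \<le> 2"
        by (intro zdvd_imp_le) simp_all
      then show False using p2 by simp
    qed
    then show ?thesis using that by blast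
  qed (use that in blast)
  then show ?thesis
  proof cases
    case 1
    have "int p ^ j dvd ((x ^ h + 1) * int p ^ v) * (x ^ h - 1)"
      using dvd' fac by (simp add: mult_ac)
    then have "int p ^ j dvd (x ^ h + 1) * int p ^ v"
      using prime_power_dvd_cancel_right[OF prime 1] by blast
    then show ?thesis
      using pos p2 unfolding h_def[symmetric] v_def[symmetric]
      by (intro zdvd_imp_le) auto
  next
    case 2
    have "int p ^ j dvd ((x ^ h - 1) * int p ^ v) * (x ^ h + 1)"
      using dvd' fac by (simp add: mult_ac)
    then have "int p ^ j dvd (x ^ h - 1) * int p ^ v"
      using prime_power_dvd_cancel_right[OF prime 2] by blast
    then have "int p ^ j \<le> (x ^ h - 1) * int p ^ v"
      using pos p2 by (intro zdvd_imp_le) auto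
    also have "\<dots> \<le> (x ^ h + 1) * int p ^ v"
      by (intro mult_right_mono) auto
    finally show ?thesis
      unfolding h_def v_def .
  qed
qed

section \<open>The prime 2\<close>

text \<open>Each further squaring contributes a factor of the form \<open>z\<^sup>2 + 1\<close> with
  \<open>z\<close> odd, which is twice an odd number. The start is \<open>x\<^sup>2 - 1\<close>
  because \<open>x + 1\<close> itself may contain a higher power of 2.\<close>

lemma lifting_the_exponent_two:
  fixes x :: int
  assumes "odd x"
  shows "\<exists>u. odd u \<and> x ^ (2 ^ Suc v) - 1 = (x\<^sup>2 - 1) * 2 ^ v * u"
proof (induction v)
  case 0
  show ?case by (intro exI[of _ 1]) simp
next
  case (Suc v)
  then obtain u where u: "odd u" "x ^ (2 ^ Suc v) - 1 = (x\<^sup>2 - 1) * 2 ^ v * u"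
    by blast
  have "odd (x ^ 2 ^ v)"
    using assms by simp
  then obtain s where s: "x ^ 2 ^ v = 2 * s + 1"
    by (elim oddE)
  have sq: "x ^ 2 ^ Suc v = (x ^ 2 ^ v)\<^sup>2"
    by (simp add: power_mult[symmetric] mult.commute)
  have *: "x ^ 2 ^ Suc v + 1 = 2 * (2 * (s\<^sup>2 + s) + 1)"
    unfolding sq s by (simp add: power2_eq_square algebra_simps)
  have "x ^ 2 ^ Suc (Suc v) = (x ^ 2 ^ Suc v)\<^sup>2"
    by (simp add: power_mult[symmetric] mult.commute)
  then have "x ^ 2 ^ Suc (Suc v) - 1 = (x ^ 2 ^ Suc v - 1) * (x ^ 2 ^ Suc v + 1)"
    by (simp only:) (simp add: power2_eq_square algebra_simps)
  also have "\<dots> = (x\<^sup>2 - 1) * 2 ^ Suc v * (u * (2 * (s\<^sup>2 + s) + 1))"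
    unfolding * u(2) by simp
  finally show ?case
    using u(1) by (intro exI[of _ "u * (2 * (s\<^sup>2 + s) + 1)"]) simp
qed

lemma two_power_dvd_power_minus_one_le:
  fixes x :: int
  assumes x: "odd x" "x > 1" and k: "k > 0" and dvd: "2 ^ j dvd x ^ k - 1"
  shows "2 ^ j \<le> (x + 1) * 2 ^ multiplicity 2 k"
proof -
  have two: "prime (2 :: int)"
    by simp
  define v where "v = multiplicity 2 k"
  obtain m where m: "k = 2 ^ v * m" "odd m"
    unfolding v_def using multiplicity_decompose'[of k 2] k by auto
  obtain u where "odd u" "(x ^ 2 ^ v) ^ m - 1 = (x ^ 2 ^ v - 1) * u"
    using power_minus_one_coprime_exponent[of 2 "x ^ 2 ^ v" m] x(1) m(2) by auto
  then have 1: "2 ^ j dvd x ^ 2 ^ v - 1"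
    using dvd m(1) prime_power_dvd_cancel_right[OF two, of u j "x ^ 2 ^ v - 1"]
    by (simp add: power_mult)
  show ?thesis
  proof (cases v)
    case 0
    then have "2 ^ j \<le> x - 1"
      using 1 x(2) by (intro zdvd_imp_le) auto
    then show ?thesis
      using 0 unfolding v_def by simp
  next
    case (Suc w)
    obtain u where u: "odd u" "x ^ (2 ^ Suc w) - 1 = (x\<^sup>2 - 1) * 2 ^ w * u"
      using lifting_the_exponent_two[OF x(1)] by blast
    have "2 ^ j dvd (x\<^sup>2 - 1) * 2 ^ w * u"
      using 1 unfolding Suc u(2) .
    then have 2: "2 ^ j dvd (x\<^sup>2 - 1) * 2 ^ w"
      using prime_power_dvd_cancel_right[OF two u(1)] by blast
    obtain s where s: "x = 2 * s + 1"
      using x(1) by (elim oddE)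
    \<comment> \<open>Here \<open>x - 1 = 2 * s\<close> and \<open>x + 1 = 2 * (s + 1)\<close>, and
      one of \<open>s\<close>, \<open>s + 1\<close> is odd. The corresponding factor of
      \<open>x\<^sup>2 - 1\<close> contributes a single 2, which turns \<open>2 ^ w\<close> into
      \<open>2 ^ v\<close>.\<close>
    show ?thesis
    proof (cases "even s")
      case True
      have "(x\<^sup>2 - 1) * 2 ^ w = ((x - 1) * 2 ^ v) * (s + 1)"
        unfolding s Suc by (simp add: power2_eq_square algebra_simps)
      then have "2 ^ j dvd (x - 1) * 2 ^ v"
        using prime_power_dvd_cancel_right[of 2 "s + 1" j "(x - 1) * 2 ^ v"] 2 True by fastforce
      then have "2 ^ j \<le> (x - 1) * 2 ^ v"
        using x(2) by (intro zdvd_imp_le) auto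
      also have "\<dots> \<le> (x + 1) * 2 ^ v"
        by (intro mult_right_mono) auto
      finally show ?thesis unfolding v_def .
    next
      case False
      have "(x\<^sup>2 - 1) * 2 ^ w = ((x + 1) * 2 ^ v) * s"
        unfolding s Suc by (simp add: power2_eq_square algebra_simps)
      then have "2 ^ j dvd (x + 1) * 2 ^ v"
        using prime_power_dvd_cancel_right[OF two False] 2 by metis
      then show ?thesis
        using x(2) unfolding v_def by (intro zdvd_imp_le) auto
    qed
  qed
qed

section \<open>Growth estimates\<close>

text \<open>For \<open>p \<ge> 4\<close>, \<open>(1 + 1/q) ^ (p + 1)\<close> is at most
  \<open>exp ((p + 1) / q)\<close>, hence at most \<open>exp (5/4) \<le> 4 \<le> p\<close>. For
  \<open>p = 3\<close> the polynomials in \<open>q - 4\<close> compare coefficientwise. The case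
  \<open>p = q = 3\<close> must be excluded, since 256 > 243.\<close>

lemma power_Suc_le_mult_power:
  fixes p q :: nat
  assumes "3 \<le> p" "p \<le> q" "4 \<le> q"
  shows "(q + 1) ^ (p + 1) \<le> p * q ^ (p + 1)"
proof (cases "p = 3")
  case True
  obtain r where r: "q = r + 4"
    using assms(3) that[of "q - 4"] by simp
  show ?thesis
    unfolding True r by (simp add: power4_eq_xxxx algebra_simps)
next
  case False
  then have p: "p \<ge> 4" using assms by simp
  have "(1 + 1 / real q) ^ (p + 1) \<le> exp (1 / real q) ^ (p + 1)"
    by (intro power_mono exp_ge_add_one_self) auto
  also have "\<dots> = exp (real (p + 1) / real q)"
    using exp_of_nat_mult[of "p + 1" "1 / real q"] by simp
  also have "\<dots> \<le> exp (5 / 4)"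
    using assms p by (simp add: field_simps)
  also have "\<dots> \<le> 4"
  proof -
    \<comment> \<open>Fourth powers reduce the claim to
      \<open>3 ^ 5 = 243 \<le> 256 = 4 ^ 4\<close>.\<close>
    have "exp (5 / 4 :: real) ^ 4 = exp 1 ^ 5"
      by (simp flip: exp_of_nat_mult)
    also have "\<dots> \<le> 3 ^ 5"
      by (intro power_mono exp_le) auto
    also have "\<dots> \<le> (4 :: real) ^ 4"
      by simp
    finally show ?thesis
      using power_le_imp_le_base[of "exp (5 / 4 :: real)" 3 4] by simp
  qed
  also have "\<dots> \<le> real p"
    using p by simp
  finally have "(1 + 1 / real q) ^ (p + 1) * real q ^ (p + 1) \<le> real p * real q ^ (p + 1)"
    by (intro mult_right_mono) auto
  also have "(1 + 1 / real q) ^ (p + 1) * real q ^ (p + 1) = (real q + 1) ^ (p + 1)"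
    unfolding power_mult_distrib[symmetric] using assms by (simp add: distrib_right)
  finally have "real ((q + 1) ^ (p + 1)) \<le> real (p * q ^ (p + 1))"
    by (simp only: of_nat_power of_nat_mult of_nat_add of_nat_1)
  then show ?thesis
    by (simp only: of_nat_le_iff)
qed

lemma power_exchange_le:
  fixes p q :: nat
  assumes "3 \<le> p" "p \<le> q"
  shows "q ^ (p + 1) \<le> p ^ (q + 2)"
  using assms(2)
proof (induction q rule: dec_induct)
  case base
  show ?case
    using assms(1) by (intro power_increasing) auto
next
  case (step q)
  show ?case
  proof (cases "q = 3")
    case True
    then have "p = 3" using assms(1) step by simp
    then show ?thesis using True by simp
  next
    case False
    have "(q + 1) ^ (p + 1) \<le> p * q ^ (p + 1)"
      using power_Suc_le_mult_power[of p q] False step assms(1) by linarith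
    also have "\<dots> \<le> p * p ^ (q + 2)"
      using step by (intro mult_left_mono) auto
    finally show ?thesis by simp
  qed
qed

text \<open>The left side is at most \<open>2 * (2 * b) ^ h * p ^ (2 * v)\<close>. Inserting
  \<open>2 * b < q\<^sup>2 / 4\<close> and \<open>p ^ v \<le> q / p\<close> leaves powers of
  \<open>q\<close> with total exponent \<open>2 * h + 2 = p + 1\<close>, which
  \<open>power_exchange_le\<close> converts into a power of \<open>p\<close>.\<close>

lemma odd_prime_estimate:
  fixes p q v :: nat and b :: int
  assumes p: "3 \<le> p" "p \<le> q" "odd p" and b: "b \<ge> 3" "8 * b < (int q)\<^sup>2"
    and v: "p ^ Suc v \<le> q"
  shows "(2 ^ ((p - 1) div 2) + 1) * (b ^ ((p - 1) div 2) + 1) * (int p ^ v)\<^sup>2 < int p ^ q"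
proof -
  define h where "h = (p - 1) div 2"
  have ph: "p = 2 * h + 1"
    using p(3) unfolding h_def by simp
  then have h: "h > 0" using p(1) by simp
  have "2 ^ 1 \<le> (2 :: int) ^ h" "b ^ 1 \<le> b ^ h"
    using h b(1) by (intro power_increasing; simp)+
  \<comment> \<open>The ratios 3/2 and 4/3 come from \<open>2 ^ h \<ge> 2\<close> and
    \<open>b ^ h \<ge> 3\<close>; their product is the constant 2 below.\<close>
  then have f: "2 * (2 ^ h + 1) \<le> 3 * (2 :: int) ^ h" "3 * (b ^ h + 1) \<le> 4 * b ^ h"
    using b(1) by simp_all
  then have "(2 * (2 ^ h + 1)) * (3 * (b ^ h + 1)) \<le> (3 * 2 ^ h) * (4 * b ^ h)"
    using b(1) by (intro mult_mono[OF f]) simp_all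
  then have F: "(2 ^ h + 1) * (b ^ h + 1) \<le> 2 * (2 * b) ^ h"
    by (simp add: power_mult_distrib algebra_simps)
  have "8 * b = 4 * (2 * b)"
    by simp
  then have "4 ^ h * (2 * b) ^ h = (8 * b) ^ h"
    by (simp only: power_mult_distrib)
  also have "\<dots> \<le> ((int q)\<^sup>2) ^ h"
    using b by (intro power_mono) auto
  also have "\<dots> = int q ^ (2 * h)"
    by (simp add: power_mult)
  finally have G: "4 ^ h * (2 * b) ^ h \<le> int q ^ (2 * h)" .
  have V: "(int p ^ v)\<^sup>2 * (int p)\<^sup>2 \<le> (int q)\<^sup>2"
  proof -
    have "int p ^ v * int p \<le> int q"
      using v by (metis mult.commute of_nat_le_iff of_nat_power power_Suc)
    then show ?thesis
      using power_mono[of "int p ^ v * int p" "int q" 2] by (simp add: power_mult_distrib)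
  qed
  \<comment> \<open>The multiplier \<open>4 ^ h * p\<^sup>2\<close> clears the denominators; its
    part \<open>4 ^ h\<close> later absorbs the constant 2 and makes the inequality strict.\<close>
  have "4 ^ h * ((2 ^ h + 1) * (b ^ h + 1) * (int p ^ v)\<^sup>2) * (int p)\<^sup>2
      = 4 ^ h * ((2 ^ h + 1) * (b ^ h + 1)) * ((int p ^ v)\<^sup>2 * (int p)\<^sup>2)"
    by (simp add: mult_ac)
  also have "\<dots> \<le> 4 ^ h * (2 * (2 * b) ^ h) * (int q)\<^sup>2"
    using b(1) by (intro mult_mono[OF mult_left_mono[OF F] V]) simp_all
  also have "\<dots> = 2 * (4 ^ h * (2 * b) ^ h) * (int q)\<^sup>2"
    by simp
  also have "\<dots> \<le> 2 * int q ^ (2 * h) * (int q)\<^sup>2"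
    by (intro mult_right_mono mult_left_mono G) simp_all
  also have "\<dots> = 2 * int q ^ (p + 1)"
    unfolding ph by (simp add: power_add power2_eq_square)
  also have "\<dots> \<le> 2 * int p ^ (q + 2)"
    using power_exchange_le[OF p(1,2)] by (metis of_nat_le_iff of_nat_power mult_left_mono zero_le_numeral)
  also have "\<dots> < 4 ^ h * int p ^ (q + 2)"
  proof -
    have "(4 :: int) ^ 1 \<le> 4 ^ h"
      using h by (intro power_increasing) auto
    then show ?thesis
      using p(1) by (intro mult_strict_right_mono) auto
  qed
  also have "\<dots> = 4 ^ h * int p ^ q * (int p)\<^sup>2"
    by (simp add: power_add power2_eq_square)
  finally have "4 ^ h * ((2 ^ h + 1) * (b ^ h + 1) * (int p ^ v)\<^sup>2) < 4 ^ h * int p ^ q"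
    by (rule mult_right_less_imp_less) simp
  then have "(2 ^ h + 1) * (b ^ h + 1) * (int p ^ v)\<^sup>2 < int p ^ q"
    by (rule mult_left_less_imp_less) simp
  then show ?thesis
    unfolding h_def .
qed

lemma cubic_less_two_power:
  fixes q :: nat
  assumes "3 \<le> q"
  shows "(q\<^sup>2 + 8) * q < 16 * 2 ^ q"
  using assms
proof (induction q rule: dec_induct)
  case (step q)
  obtain r where r: "q = r + 3"
    using step(1) that[of "q - 3"] by simp
  have "((Suc q)\<^sup>2 + 8) * Suc q \<le> 2 * ((q\<^sup>2 + 8) * q)"
    unfolding r by (simp add: power2_eq_square algebra_simps)
  then show ?case using step by simp
qed simp

section \<open>The exponent is divisible by \<open>q\<close>\<close>

text \<open>Strong induction on \<open>p\<close>: the claim for the primes below \<open>p\<close>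
  gives \<open>p - 1 dvd k\<close>, hence \<open>p ^ q\<close> divides the product. If
  \<open>p ^ Suc v \<le> q\<close>, the lifting bounds make that power too large.\<close>

lemma prime_power_multiplicity_gt:
  fixes b y :: int and q k :: nat
  assumes b: "b \<ge> 3" "odd b" "8 * b < (int q)\<^sup>2" and k: "k > 0"
    and eq: "(2 ^ k - 1) * (b ^ k - 1) = y ^ q"
    and p: "prime p" "p \<le> q"
  shows "q < p ^ Suc (multiplicity p k)"
  using p
proof (induction p rule: less_induct)
  case (less p)
  define v where "v = multiplicity p k"
  show ?case
  proof (rule ccontr)
    assume "\<not> ?thesis"
    then have v: "p ^ Suc v \<le> q"
      unfolding v_def by simp
    show False
    proof (cases "p = 2")
      case True
      have "even (y ^ q)"
        using b(2) by (simp flip: eq)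
      then have "2 ^ q dvd y ^ q"
        by (intro dvd_power_same) simp
      \<comment> \<open>As \<open>2 ^ k - 1\<close> is odd, the whole power of 2 falls on the other
        factor.\<close>
      then have "2 ^ q dvd b ^ k - 1"
        using prime_power_dvd_cancel_right[of 2 "2 ^ k - 1" q "b ^ k - 1"] eq k
        by (simp add: mult.commute)
      then have "2 ^ q \<le> (b + 1) * 2 ^ v"
        using two_power_dvd_power_minus_one_le[of b k q] b k True unfolding v_def by simp
      \<comment> \<open>The factor 16 is split as 8 * 2 so that \<open>8 * b < q\<^sup>2\<close> and
        \<open>2 ^ Suc v \<le> q\<close> can be inserted.\<close>
      then have "16 * 2 ^ q \<le> (8 * b + 8) * 2 ^ Suc v"
        by (simp add: algebra_simps)
      also have "\<dots> \<le> ((int q)\<^sup>2 + 8) * int q"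
      proof (intro mult_mono)
        show "2 ^ Suc v \<le> int q"
          using v True by (metis of_nat_le_iff of_nat_numeral of_nat_power)
      qed (use b in auto)
      finally have "int (16 * 2 ^ q) \<le> int ((q\<^sup>2 + 8) * q)"
        by simp
      moreover have "q \<ge> 3"
      proof (rule ccontr)
        assume "\<not> q \<ge> 3"
        then have "(int q)\<^sup>2 \<le> 2\<^sup>2"
          by (intro power_mono) auto
        then show False using b by simp
      qed
      ultimately show False
        using cubic_less_two_power[of q] by (metis not_less of_nat_le_iff)
    next
      case False
      then have p3: "p \<ge> 3"
        using prime_ge_2_nat[OF less.prems(1)] by simp
      then have podd: "odd p"
        using prime_odd_nat less.prems(1) by simp
      \<comment> \<open>Checked prime by prime: the \<open>r\<close>-part of \<open>p - 1\<close> is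
        less than \<open>q\<close>, while the induction hypothesis puts \<open>q\<close> below
        \<open>r ^ Suc (multiplicity r k)\<close>.\<close>
      have p1: "p - 1 dvd k"
      proof (rule multiplicity_le_imp_dvd)
        fix r :: nat assume r: "prime r"
        show "multiplicity r (p - 1) \<le> multiplicity r k"
        proof (cases "r dvd p - 1")
          case True
          then have "r \<le> p - 1"
            using p3 by (intro dvd_imp_le) auto
          then have IH: "q < r ^ Suc (multiplicity r k)"
            using less p3 r by simp
          have "r ^ multiplicity r (p - 1) \<le> p - 1"
            using p3 by (intro dvd_imp_le multiplicity_dvd) auto
          also have "\<dots> < r ^ Suc (multiplicity r k)"
            using IH less.prems by simp
          finally show ?thesis
            using r prime_gt_1_nat by (metis less_Suc_eq_le power_less_imp_less_exp)
        qed (simp add: not_dvd_imp_multiplicity_0)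
      qed (use p3 in simp)
      have "int p dvd 2 ^ k - 1"
      proof -
        have "\<not> int p dvd 2"
          using p3 zdvd_imp_le[of "int p" 2] by auto
        then have "[2 ^ (p - 1) = 1] (mod int p)"
          using fermat_theorem_int[OF less.prems(1)] by blast
        moreover obtain c where "k = (p - 1) * c"
          using p1 by blast
        ultimately have "[2 ^ k = 1] (mod int p)"
          using cong_pow[of "2 ^ (p - 1)" 1 "int p" c] by (simp add: power_mult)
        then show ?thesis
          by (simp add: cong_iff_dvd_diff)
      qed
      then have "int p dvd y ^ q"
        by (simp flip: eq)
      then have "int p dvd y"
        using less.prems(1) prime_dvd_power[of "int p"] by simp
      then have "int p ^ q dvd (2 ^ k - 1) * (b ^ k - 1)"
        unfolding eq by (rule dvd_power_same)
      \<comment> \<open>The \<open>q\<close> factors \<open>p\<close> are distributed over the two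
        factors of the product, and each share is bounded separately.\<close>
      then obtain i j where ij: "i + j = q" "int p ^ i dvd 2 ^ k - 1" "int p ^ j dvd b ^ k - 1"
        using prime_elem_power_dvd_prod[of "int p"] less.prems(1)
        by (metis prime_imp_prime_elem prime_nat_int_transfer)
      have "int p ^ q = int p ^ i * int p ^ j"
        using ij(1) by (simp flip: power_add)
      also have "\<dots> \<le> ((2 ^ ((p - 1) div 2) + 1) * int p ^ v) * ((b ^ ((p - 1) div 2) + 1) * int p ^ v)"
        unfolding v_def
        using odd_prime_power_dvd_power_minus_one_le[OF less.prems(1) podd _ k p1] ij(2,3) b(1)
        by (intro mult_mono) auto
      also have "\<dots> = (2 ^ ((p - 1) div 2) + 1) * (b ^ ((p - 1) div 2) + 1) * (int p ^ v)\<^sup>2"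
        by (simp add: power2_eq_square mult_ac)
      also have "\<dots> < int p ^ q"
        using odd_prime_estimate[OF p3 less.prems(2) podd b(1,3) v] .
      finally show False by simp
    qed
  qed
qed

section \<open>Squeezing between consecutive \<open>q\<close>-th powers\<close>

text \<open>With \<open>T = 2 ^ m\<close> and \<open>B = b ^ m\<close>, the product is below
  \<open>(T * B) ^ q\<close>, so \<open>y \<le> T * B - 1\<close>. This forces
  \<open>(T * B) ^ (q - 1) < T ^ q + B ^ q\<close>, which fails because neither of \<open>T\<close>,
  \<open>B\<close> exceeds the \<open>(q - 2)\<close>-th power of the other.\<close>

lemma not_perfect_power_of_exponent_dvd:
  fixes b y :: int and q m :: nat
  assumes b: "b \<ge> 3" "8 * b < (int q)\<^sup>2" and m: "m > 0" and y: "y > 0"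
  shows "(2 ^ (q * m) - 1) * (b ^ (q * m) - 1) \<noteq> y ^ q"
proof
  assume eq: "(2 ^ (q * m) - 1) * (b ^ (q * m) - 1) = y ^ q"
  have q: "q \<ge> 5"
  proof (rule ccontr)
    assume "\<not> q \<ge> 5"
    then have "(int q)\<^sup>2 \<le> 4\<^sup>2"
      by (intro power_mono) auto
    then show False using b by simp
  qed
  define T B :: int where "T = 2 ^ m" and "B = b ^ m"
  have T: "T \<ge> 2"
    using m power_increasing[of 1 m "2 :: int"] unfolding T_def by simp
  have B: "B \<ge> T + 1"
  proof -
    have "T < B"
      unfolding T_def B_def using m b(1) by (intro power_strict_mono) auto
    then show ?thesis by simp
  qed
  obtain r where r: "q = r + 2"
    using q that[of "q - 2"] by simp
  have eq': "(T ^ q - 1) * (B ^ q - 1) = y ^ q"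
    using eq unfolding T_def B_def by (simp add: power_mult[symmetric] mult.commute)
  have "T ^ q > 1" "B ^ q > 1"
    using T B q by (auto intro!: one_less_power)
  then have "(T ^ q - 1) * (B ^ q - 1) < T ^ q * B ^ q"
    by (simp add: algebra_simps)
  then have "y ^ q < (T * B) ^ q"
    unfolding eq' by (simp add: power_mult_distrib)
  then have "y < T * B"
    using T B by (intro power_less_imp_less_base[of y q]) auto
  then have "y ^ q \<le> (T * B - 1) ^ q"
    using y by (intro power_mono) auto
  also have "\<dots> = (T * B - 1) * (T * B - 1) ^ (r + 1)"
    using r by simp
  also have "\<dots> \<le> (T * B - 1) * (T * B) ^ (r + 1)"
    using \<open>y < T * B\<close> y by (intro mult_left_mono power_mono) auto
  also have "\<dots> = (T * B) ^ q - (T * B) ^ (r + 1)"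
    using r by (simp add: algebra_simps)
  finally have main: "(T * B) ^ (r + 1) < T ^ q + B ^ q"
    unfolding eq'[symmetric] by (simp add: algebra_simps power_mult_distrib)
  \<comment> \<open>The bound \<open>8 * b < q\<^sup>2\<close> enters here:
    \<open>q\<^sup>2 \<le> 8 * 2 ^ (q - 2)\<close> for \<open>q \<ge> 5\<close>, so
    \<open>b \<le> 2 ^ r\<close>.\<close>
  have "B \<le> T ^ r"
  proof -
    have "(int q)\<^sup>2 \<le> 8 * 2 ^ r"
    proof -
      have "(n + 5)\<^sup>2 \<le> 8 * 2 ^ (n + 3)" for n :: nat
      proof (induction n)
        case (Suc n)
        have "(Suc n + 5)\<^sup>2 \<le> 2 * (n + 5)\<^sup>2"
          by (simp add: power2_eq_square algebra_simps)
        also have "\<dots> \<le> 2 * (8 * 2 ^ (n + 3))"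
          using Suc by simp
        finally show ?case by (simp add: power_add)
      qed simp
      moreover have "q - 5 + 5 = q" "q - 5 + 3 = r"
        using q r by simp_all
      ultimately have "q\<^sup>2 \<le> 8 * 2 ^ r"
        by metis
      then have "int (q\<^sup>2) \<le> int (8 * 2 ^ r)"
        by (simp only: of_nat_le_iff)
      then show ?thesis by simp
    qed
    then have "b \<le> 2 ^ r"
      using b by simp
    then have "b ^ m \<le> (2 ^ r) ^ m"
      using b by (intro power_mono) auto
    then show ?thesis
      unfolding T_def B_def by (simp add: power_mult[symmetric] mult.commute)
  qed
  then have 1: "B * B ^ (r + 1) \<le> T ^ r * B ^ (r + 1)"
    using B T by (intro mult_right_mono) auto
  have "T \<le> B ^ r"
  proof -
    have "B ^ 1 \<le> B ^ r"
      using B T q r by (intro power_increasing) auto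
    then show ?thesis using B by simp
  qed
  then have "T * (T * T ^ r) \<le> B ^ r * (B * T ^ r)"
    using B T by (intro mult_mono) auto
  then have "T ^ q + B ^ q \<le> 2 * (T ^ r * B ^ (r + 1))"
    using 1 r by (simp add: mult_ac)
  also have "\<dots> \<le> T * (T ^ r * B ^ (r + 1))"
    using B T by (intro mult_right_mono) auto
  also have "\<dots> = (T * B) ^ (r + 1)"
    by (simp add: power_mult_distrib mult_ac)
  finally show False
    using main by simp
qed

theorem theorem2:
  fixes b :: int and q :: nat
  assumes "b > 0" and "odd b"
    and "prime q" and "odd q"
    and "real q > 2 * sqrt (2 * real_of_int b)"
  shows "\<not> (\<exists>(k::nat) (y::int). k > 0 \<and> y > 0 \<and> (2 ^ k - 1) * (b ^ k - 1) = y ^ q)"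
proof
  assume "\<exists>(k::nat) (y::int). k > 0 \<and> y > 0 \<and> (2 ^ k - 1) * (b ^ k - 1) = y ^ q"
  then obtain k :: nat and y :: int
    where k: "k > 0" and y: "y > 0" and eq: "(2 ^ k - 1) * (b ^ k - 1) = y ^ q"
    by blast
  \<comment> \<open>For \<open>b = 1\<close> the product would be 0, against
    \<open>y > 0\<close>.\<close>
  have "b \<noteq> 1"
    using eq y by auto
  then have b: "b \<ge> 3"
    using assms(1,2) by (cases "b = 2") auto
  have "(2 * sqrt (2 * real_of_int b))\<^sup>2 < (real q)\<^sup>2"
    using assms(1,5) by (intro power_strict_mono) auto
  then have "real_of_int (8 * b) < real_of_int ((int q)\<^sup>2)"
    using assms(1) by (simp add: power_mult_distrib)
  then have bq: "8 * b < (int q)\<^sup>2"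
    by (simp only: of_int_less_iff)
  \<comment> \<open>The case \<open>p = q\<close>: multiplicity 0 would give
    \<open>q < q\<close>.\<close>
  have "q < q ^ Suc (multiplicity q k)"
    using prime_power_multiplicity_gt[OF b assms(2) bq k eq assms(3)] by simp
  then have "multiplicity q k > 0"
    by (cases "multiplicity q k") auto
  then have "q dvd k"
    using not_dvd_imp_multiplicity_0 by fastforce
  then obtain m where "k = q * m"
    by blast
  then show False
    using not_perfect_power_of_exponent_dvd[OF b bq _ y, of m] eq k by simp
qed

end
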